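(* Let $K$ be a field and let $\mathcal{P}\subset \mathbb{R}_{\ge 0}^n$ be an anti-blocking lattice polytope of dimension $n$, and let $\mathcal{P}^{\pm}=\{\varepsilon\mathbf{x} : \varepsilon\in\{-1,1\}^n,\ \mathbf{x}\in\mathcal{P}\}$. Then the toric ideal $I_{\mathcal{P}}$ is generated by quadratic binomials if and only if the toric ideal $I_{\mathcal{P}^{\pm}}$ is generated by quadratic binomials.
   Context: A lattice polytope is a convex polytope whose vertices have integer coordinates. A lattice polytope $\mathcal{P}\subset\mathbb{R}_{\ge0}^n$ of dimension $n$ is anti-blocking if for every $\mathbf{y}\in\mathcal{P}$ and every $\mathbf{x}\in\mathbb{R}^n$ with $0\le x_i\le y_i$ for all $i$, one has $\mathbf{x}\in\mathcal{P}$. For $\varepsilon\in\{-1,1\}^n$ and $\mathbf{x}\in\mathbb{R}^n$, $\varepsilon\mathbf{x}:=(\varepsilon_1x_1,\dots,\varepsilon_nx_n)$; $\mathcal{P}^{\pm}$ is a convex lattice polytope. For a lattice polytope $\mathcal{Q}\subset\mathbb{R}^n$ with $\mathcal{Q}\cap\mathbb{Z}^n=\{\mathbf{a}_1,\dots,\mathbf{a}_m\}$, the toric ring $K[\mathcal{Q}]$ is the subalgebra of $K[t_1^{\pm1},\dots,t_n^{\pm1},s]$ generated by $\mathbf{t}^{\mathbf{a}_i}s$ ($1\le i\le m$), and the toric ideal $I_{\mathcal{Q}}$ is the kernel of the surjective $K$-algebra homomorphism $K[x_1,\dots,x_m]\to K[\mathcal{Q}]$, $x_i\mapsto \mathbf{t}^{\mathbf{a}_i}s$.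 *)

theory Defs
  imports
    "HOL-Analysis.Analysis"
    "HOL-Library.Poly_Mapping"
    "HOL-Library.Product_Plus"
    "HOL-Algebra.Generated_Rings"
    "HOL-Algebra.Ideal"
begin

definition lattice_polytope :: "(real ^ 'n) set \<Rightarrow> bool" where
  "lattice_polytope P \<longleftrightarrow>
     polytope P \<and> (\<forall>v. v extreme_point_of P \<longrightarrow> (\<forall>i. v $ i \<in> \<int>))"

definition anti_blocking :: "(real ^ 'n) set \<Rightarrow> bool" where
  "anti_blocking P \<longleftrightarrow>
     (\<forall>y\<in>P. \<forall>x. (\<forall>i. 0 \<le> x $ i \<and> x $ i \<le> y $ i) \<longrightarrow> x \<in> P)"

definition signed_copies :: "(real ^ 'n) set \<Rightarrow> (real ^ 'n) set" where
  "signed_copies P = {\<chi> i. \<epsilon> $ i * x $ i | \<epsilon> x. (\<forall>i. \<epsilon> $ i \<in> {-1, 1}) \<and> x \<in> P}"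

definition lattice_points :: "(real ^ 'n) set \<Rightarrow> (int ^ 'n) set" where
  "lattice_points Q = {a. (\<chi> i. real_of_int (a $ i)) \<in> Q}"

(* The commutative ring type of finitely supported maps from exponents to coefficients is the
   monoid algebra.  With exponents in ('v =>0 nat) it is the polynomial ring in variables 'v; with
   exponents in int ^ 'n x nat it is K[t_1^(+-1), ..., t_n^(+-1), s]. *)

type_synonym ('v, 'k) mpoly = "('v \<Rightarrow>\<^sub>0 nat) \<Rightarrow>\<^sub>0 'k"
type_synonym ('n, 'k) laurent = "((int ^ 'n) \<times> nat) \<Rightarrow>\<^sub>0 'k"

definition poly_ring :: "'v set \<Rightarrow> ('v, 'k::field) mpoly ring" where
  "poly_ring V =
     \<lparr>carrier = {p. \<forall>m\<in>Poly_Mapping.keys p. Poly_Mapping.keys m \<subseteq> V},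
      mult = (*), one = 1, zero = 0, add = (+)\<rparr>"

definition laurent_ring :: "('n::finite, 'k::field) laurent ring" where
  "laurent_ring = \<lparr>carrier = UNIV, mult = (*), one = 1, zero = 0, add = (+)\<rparr>"

definition toric_monomial :: "int ^ 'n \<Rightarrow> ('n::finite, 'k::field) laurent" where
  "toric_monomial a = Poly_Mapping.single (a, 1) 1"

(* The constants are among the generators, so the generated subring is the K-subalgebra
   generated by the monomials t^a s. *)
definition toric_ring :: "(real ^ 'n) set \<Rightarrow> ('n::finite, 'k::field) laurent ring" where
  "toric_ring Q = laurent_ring
     \<lparr>carrier := generate_ring laurent_ring
        (range (Poly_Mapping.single 0) \<union> toric_monomial ` lattice_points Q)\<rparr>"

(* Evaluation at x_a = t^a s, as a K-algebra homomorphism. *)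
definition toric_hom :: "(int ^ 'n, 'k::field) mpoly \<Rightarrow> ('n::finite, 'k) laurent" where
  "toric_hom p = (\<Sum>m\<in>Poly_Mapping.keys p. Poly_Mapping.single 0 (Poly_Mapping.lookup p m) *
     (\<Prod>a\<in>Poly_Mapping.keys m. toric_monomial a ^ Poly_Mapping.lookup m a))"

(* The variables of the polynomial ring are indexed by the lattice points themselves rather than
   by an enumeration a_1, ..., a_m of them. *)
definition toric_ideal :: "(real ^ 'n) set \<Rightarrow> (int ^ 'n::finite, 'k::field) mpoly set" where
  "toric_ideal Q = a_kernel (poly_ring (lattice_points Q)) (toric_ring Q) toric_hom"

definition monomial_degree :: "('v \<Rightarrow>\<^sub>0 nat) \<Rightarrow> nat" where
  "monomial_degree m = (\<Sum>v\<in>Poly_Mapping.keys m. Poly_Mapping.lookup m v)"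

definition quadratic_binomial :: "('v, 'k::field) mpoly \<Rightarrow> bool" where
  "quadratic_binomial f \<longleftrightarrow>
     (\<exists>u v. u \<noteq> v \<and> monomial_degree u = 2 \<and> monomial_degree v = 2 \<and>
        f = Poly_Mapping.single u 1 - Poly_Mapping.single v 1)"

(* The generating set may be empty: the zero ideal counts as generated by quadratic binomials. *)
definition generated_by_quadratic_binomials ::
  "('v, 'k::field) mpoly ring \<Rightarrow> ('v, 'k) mpoly set \<Rightarrow> bool" where
  "generated_by_quadratic_binomials R I \<longleftrightarrow>
     (\<exists>B \<subseteq> carrier R. (\<forall>f\<in>B. quadratic_binomial f) \<and> I = Idl\<^bsub>R\<^esub> B)"

end

theory Submission
  imports Defs
begin

text \<open>
  A toric ideal is generated by quadratic binomials iff any two multisets of lattice points with the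
  same size and the same sum are connected by moves replacing a pair \<open>a, b\<close> by a pair \<open>c, d\<close> with
  \<open>a + b = c + d\<close>; this leaves a combinatorial statement about a down-closed set \<open>A\<close> of nonnegative
  lattice points and its set \<open>S\<close> of signed copies.

  From \<open>A\<close> to \<open>S\<close>: if \<open>a\<close> is positive and \<open>b\<close> negative in coordinate \<open>i\<close>, move to \<open>a - e\<^sub>i, b + e\<^sub>i\<close>.
  This terminates in a multiset lying in one orthant, which is determined by the sum, and in a single
  orthant \<open>S\<close> is a reflected \<open>A\<close>.

  From \<open>S\<close> to \<open>A\<close>: along a path in \<open>S\<close> with nonnegative sum \<open>\<sigma>\<close>, replace every point \<open>x\<close> by a point
  between \<open>0\<close> and its positive part so that the sum remains \<open>\<sigma>\<close>.  Different choices of replacements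
  are connected in \<open>A\<close> by moving unit vectors, and for each move in \<open>S\<close> the replacements can be chosen
  to differ by a single move in \<open>A\<close>.
\<close>

section \<open>Quadratic moves between multisets\<close>

text \<open>The rest \<open>R\<close> is left unconstrained, so a move can be made inside any larger
  multiset; membership in \<open>V\<close> is carried along a path from its first multiset. The two
  pairs may coincide, so a move may be trivial.\<close>

definition quadratic_move :: "'a::comm_monoid_add set \<Rightarrow> 'a multiset \<Rightarrow> 'a multiset \<Rightarrow> bool" where
  "quadratic_move V M N \<longleftrightarrow>
     (\<exists>a b c d R. {a, b, c, d} \<subseteq> V \<and> a + b = c + d \<and> M = {#a, b#} + R \<and> N = {#c, d#} + R)"

abbreviation connected_by_moves :: "'a::comm_monoid_add set \<Rightarrow> 'a multiset \<Rightarrow> 'a multiset \<Rightarrow> bool" where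
  "connected_by_moves V \<equiv> (quadratic_move V)\<^sup>*\<^sup>*"

definition quadratically_connected :: "'a::comm_monoid_add set \<Rightarrow> bool" where
  "quadratically_connected V \<longleftrightarrow>
     (\<forall>M N. set_mset M \<subseteq> V \<longrightarrow> set_mset N \<subseteq> V \<longrightarrow> size M = size N \<longrightarrow> \<Sum>\<^sub># M = \<Sum>\<^sub># N \<longrightarrow>
        connected_by_moves V M N)"

lemma quadratic_moveI:
  "\<lbrakk>a \<in> V; b \<in> V; c \<in> V; d \<in> V; a + b = c + d\<rbrakk>
     \<Longrightarrow> quadratic_move V ({#a, b#} + R) ({#c, d#} + R)"
  unfolding quadratic_move_def by blast

lemma equivp_connected_by_moves: "equivp (connected_by_moves V)"
proof (rule equivp_rtranclp, rule sympI)
  fix M N assume "quadratic_move V M N"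
  then obtain a b c d R where "{a, b, c, d} \<subseteq> V" "a + b = c + d" "M = {#a, b#} + R" "N = {#c, d#} + R"
    unfolding quadratic_move_def by blast
  then show "quadratic_move V N M" using quadratic_moveI[of c V d a b R] by simp
qed

lemma connected_by_moves_sym: "connected_by_moves V M N \<Longrightarrow> connected_by_moves V N M"
  using equivp_symp[OF equivp_connected_by_moves] .

lemma connected_by_moves_add:
  assumes "connected_by_moves V M N"
  shows "connected_by_moves V (M + R) (N + R)"
  using assms
proof (induction rule: rtranclp_induct)
  case (step N N')
  have "quadratic_move V (N + R) (N' + R)"
    using step.hyps(2) unfolding quadratic_move_def by (metis add.assoc)
  with step.IH show ?case by simp
qed simp

lemma connected_by_moves_invariants:
  assumes "connected_by_moves V M N"
  shows "size N = size M" and "\<Sum>\<^sub># N = \<Sum>\<^sub># M" and "set_mset M \<subseteq> V \<Longrightarrow> set_mset N \<subseteq> V"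
proof -
  have "size N = size M \<and> \<Sum>\<^sub># N = \<Sum>\<^sub># M \<and> (set_mset M \<subseteq> V \<longrightarrow> set_mset N \<subseteq> V)"
    using assms
  proof (induction rule: rtranclp_induct)
    case (step N N')
    then obtain a b c d R where "{a, b, c, d} \<subseteq> V" "a + b = c + d" "N = {#a, b#} + R" "N' = {#c, d#} + R"
      unfolding quadratic_move_def by blast
    moreover from this have "\<Sum>\<^sub># N' = \<Sum>\<^sub># N" by (simp flip: add.assoc)
    ultimately show ?case using step.IH by auto
  qed simp
  then show "size N = size M" and "\<Sum>\<^sub># N = \<Sum>\<^sub># M" and "set_mset M \<subseteq> V \<Longrightarrow> set_mset N \<subseteq> V" by auto
qed

lemma connected_by_moves_image:
  assumes "connected_by_moves V M N" and "\<And>x y. f (x + y) = f x + f y" and "f ` V \<subseteq> W"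
  shows "connected_by_moves W (image_mset f M) (image_mset f N)"
  using assms(1)
proof (induction rule: rtranclp_induct)
  case (step N N')
  then obtain a b c d R where *: "{a, b, c, d} \<subseteq> V" "a + b = c + d" "N = {#a, b#} + R" "N' = {#c, d#} + R"
    unfolding quadratic_move_def by blast
  have "f a + f b = f c + f d" using *(2) assms(2) by metis
  then have "quadratic_move W ({#f a, f b#} + image_mset f R) ({#f c, f d#} + image_mset f R)"
    using * assms(3) by (intro quadratic_moveI) auto
  with * step.IH show ?case by simp
qed simp

lemma sum_mset_nth: "\<Sum>\<^sub># M $ i = (\<Sum>x\<in>#M. x $ i)"
  by (induction M) auto

lemma sum_mset_nonneg:
  fixes f :: "'a \<Rightarrow> 'b::ordered_comm_monoid_add"
  shows "(\<And>x. x \<in># M \<Longrightarrow> 0 \<le> f x) \<Longrightarrow> 0 \<le> (\<Sum>x\<in>#M. f x)"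
  by (induction M) auto

lemma sum_mset_nonneg_eq_0:
  fixes f :: "'a \<Rightarrow> 'b::ordered_comm_monoid_add"
  assumes "\<And>x. x \<in># M \<Longrightarrow> 0 \<le> f x" "(\<Sum>x\<in>#M. f x) = 0" "x \<in># M"
  shows "f x = 0"
  using assms by (induction M) (auto simp: add_nonneg_eq_0_iff sum_mset_nonneg)

section \<open>Down-closed sets and their signed copies\<close>

definition down_closed :: "(int ^ 'n) set \<Rightarrow> bool" where
  "down_closed A \<longleftrightarrow> (\<forall>y\<in>A. \<forall>x. (\<forall>i. 0 \<le> x $ i \<and> x $ i \<le> y $ i) \<longrightarrow> x \<in> A)"

lemma down_closedD: "\<lbrakk>down_closed A; y \<in> A; \<And>i. 0 \<le> x $ i; \<And>i. x $ i \<le> y $ i\<rbrakk> \<Longrightarrow> x \<in> A"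
  unfolding down_closed_def by blast

text \<open>
  The multiset of pairs matches the elements of two multisets; each step moves one unit vector
  from a first component exceeding its partner to one falling short of it.
\<close>

lemma connected_by_moves_couple:
  fixes T :: "((int ^ 'n) \<times> (int ^ 'n)) multiset"
  assumes A: "down_closed A"
    and T: "\<And>y z. (y, z) \<in># T \<Longrightarrow> (\<forall>i. 0 \<le> y $ i \<and> 0 \<le> z $ i) \<and> (\<chi> i. max (y $ i) (z $ i)) \<in> A"
    and "\<Sum>\<^sub># (image_mset fst T) = \<Sum>\<^sub># (image_mset snd T)"
  shows "connected_by_moves A (image_mset fst T) (image_mset snd T)"
  using T assms(3)
\<comment> \<open>The measure is the total l1 distance between partners; each step lowers the
  distances of the two pairs that it touches by one.\<close>
proof (induction "\<Sum>(y, z)\<in>#T. (\<Sum>i\<in>UNIV. nat \<bar>y $ i - z $ i\<bar>)" arbitrary: T rule: less_induct)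
  case less
  show ?case
  proof (cases "\<forall>(y, z)\<in>#T. y = z")
    case True
    then have "image_mset fst T = image_mset snd T" by (intro image_mset_cong) auto
    then show ?thesis by simp
  next
    case False
    \<comment> \<open>In every coordinate the differences of partners cancel, so an excess in one
      pair forces a shortfall in another pair.\<close>
    have zero: "(\<Sum>p\<in>#T. fst p $ i - snd p $ i) = 0" for i
    proof -
      have "(\<Sum>p\<in>#T. fst p $ i - snd p $ i) = (\<Sum>\<^sub># (image_mset fst T) - \<Sum>\<^sub># (image_mset snd T)) $ i"
        by (induction T) auto
      then show ?thesis using less.prems(2) by simp
    qed
    from False obtain i where ne: "\<exists>(y, z)\<in>#T. y $ i \<noteq> z $ i" by (auto simp: vec_eq_iff)
    have up: "\<exists>(y, z)\<in>#T. y $ i > z $ i"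
    proof (rule ccontr)
      assume "\<not> ?thesis"
      then have nonneg: "\<And>p. p \<in># T \<Longrightarrow> 0 \<le> snd p $ i - fst p $ i" by force
      have "(\<Sum>p\<in>#T. snd p $ i - fst p $ i) = - (\<Sum>p\<in>#T. fst p $ i - snd p $ i)"
        by (induction T) auto
      then have "(\<Sum>p\<in>#T. snd p $ i - fst p $ i) = 0" using zero by simp
      from sum_mset_nonneg_eq_0[OF nonneg this] have "\<And>p. p \<in># T \<Longrightarrow> snd p $ i - fst p $ i = 0" .
      with ne show False by force
    qed
    have down: "\<exists>(y, z)\<in>#T. y $ i < z $ i"
    proof (rule ccontr)
      assume "\<not> ?thesis"
      then have "\<And>p. p \<in># T \<Longrightarrow> 0 \<le> fst p $ i - snd p $ i" by force
      from sum_mset_nonneg_eq_0[OF this zero] have "\<And>p. p \<in># T \<Longrightarrow> fst p $ i - snd p $ i = 0" .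
      with ne show False by force
    qed
    from up obtain y z where yz: "(y, z) \<in># T" "y $ i > z $ i" by auto
    then obtain T1 where T1: "T = add_mset (y, z) T1" by (metis mset_add)
    from down yz obtain y' z' where yz': "(y', z') \<in># T1" "y' $ i < z' $ i" unfolding T1 by auto
    then obtain R where "T1 = add_mset (y', z') R" by (metis mset_add)
    with T1 have R: "T = {#(y, z), (y', z')#} + R" by simp
    \<comment> \<open>The exchange keeps both componentwise maxima in \<open>A\<close>:
      \<open>w\<close> only decreases \<open>y\<close>, and \<open>y' $ i + 1\<close> does not
      exceed \<open>z' $ i\<close>, so the maximum of \<open>w'\<close> and \<open>z'\<close> is the
      old one. This is why the hypothesis speaks of maxima and not only of the points
      themselves.\<close>
    define w where "w = y - axis i 1"
    define w' where "w' = y' + axis i 1"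
    have comp: "w $ j = (if j = i then y $ j - 1 else y $ j)"
      "w' $ j = (if j = i then y' $ j + 1 else y' $ j)" for j
      by (auto simp: w_def w'_def axis_def)
    let ?S = "{#(w, z), (w', z')#} + R"
    have prem: "(\<forall>j. 0 \<le> y $ j \<and> 0 \<le> z $ j) \<and> (\<chi> j. max (y $ j) (z $ j)) \<in> A"
      "(\<forall>j. 0 \<le> y' $ j \<and> 0 \<le> z' $ j) \<and> (\<chi> j. max (y' $ j) (z' $ j)) \<in> A"
      using less.prems(1)[of y z] less.prems(1)[of y' z'] R by auto
    have wz: "(\<forall>j. 0 \<le> w $ j \<and> 0 \<le> z $ j) \<and> (\<chi> j. max (w $ j) (z $ j)) \<in> A"
    proof (intro conjI)
      show "\<forall>j. 0 \<le> w $ j \<and> 0 \<le> z $ j" using prem(1) yz(2) by (smt (verit) comp)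
      show "(\<chi> j. max (w $ j) (z $ j)) \<in> A"
        by (rule down_closedD[OF A conjunct2[OF prem(1)]]) (use prem(1) in \<open>auto simp: comp le_max_iff_disj\<close>)
    qed
    have wz': "(\<forall>j. 0 \<le> w' $ j \<and> 0 \<le> z' $ j) \<and> (\<chi> j. max (w' $ j) (z' $ j)) \<in> A"
    proof (intro conjI)
      show "\<forall>j. 0 \<le> w' $ j \<and> 0 \<le> z' $ j" using prem(2) by (smt (verit) comp)
      show "(\<chi> j. max (w' $ j) (z' $ j)) \<in> A"
        by (rule down_closedD[OF A conjunct2[OF prem(2)]]) (use prem(2) yz'(2) in \<open>auto simp: comp le_max_iff_disj\<close>)
    qed
    have in_A: "x \<in> A" if "(\<forall>j. 0 \<le> x $ j \<and> 0 \<le> z $ j) \<and> (\<chi> j. max (x $ j) (z $ j)) \<in> A" for x z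
      by (rule down_closedD[OF A conjunct2[OF that]]) (use that in auto)
    have sum_eq: "y + y' = w + w'" by (simp add: w_def w'_def)
    have move: "quadratic_move A (image_mset fst T) (image_mset fst ?S)"
      using quadratic_moveI[OF in_A[OF prem(1)] in_A[OF prem(2)] in_A[OF wz] in_A[OF wz'] sum_eq]
      by (simp add: R)
    have "(\<Sum>j\<in>UNIV. nat \<bar>w $ j - z $ j\<bar>) < (\<Sum>j\<in>UNIV. nat \<bar>y $ j - z $ j\<bar>)"
      by (rule sum_strict_mono_ex1; use yz(2) in \<open>auto simp: comp\<close>)
    moreover have "(\<Sum>j\<in>UNIV. nat \<bar>w' $ j - z' $ j\<bar>) < (\<Sum>j\<in>UNIV. nat \<bar>y' $ j - z' $ j\<bar>)"
      by (rule sum_strict_mono_ex1; use yz'(2) in \<open>auto simp: comp\<close>)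
    ultimately have "(\<Sum>(y, z)\<in>#?S. (\<Sum>i\<in>UNIV. nat \<bar>y $ i - z $ i\<bar>)) < (\<Sum>(y, z)\<in>#T. (\<Sum>i\<in>UNIV. nat \<bar>y $ i - z $ i\<bar>))"
      by (simp add: R)
    moreover have "\<Sum>\<^sub># (image_mset fst ?S) = \<Sum>\<^sub># (image_mset snd ?S)"
      using less.prems(2) sum_eq by (simp add: R flip: add.assoc)
    moreover have "(\<forall>i. 0 \<le> u $ i \<and> 0 \<le> v $ i) \<and> (\<chi> i. max (u $ i) (v $ i)) \<in> A" if "(u, v) \<in># ?S" for u v
      using that wz wz' less.prems(1)[of u v] R by auto
    ultimately have "connected_by_moves A (image_mset fst ?S) (image_mset snd ?S)"
      by (intro less.hyps) blast+
    moreover have "image_mset snd ?S = image_mset snd T" by (simp add: R)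
    ultimately show ?thesis using move by (metis converse_rtranclp_into_rtranclp)
  qed
qed

section \<open>From signed points back to nonnegative points\<close>

definition shrinks :: "int ^ 'n \<Rightarrow> int ^ 'n \<Rightarrow> bool" where
  "shrinks x y \<longleftrightarrow> (\<forall>i. 0 \<le> y $ i \<and> y $ i \<le> max 0 (x $ i))"

text \<open>Integer counterpart of \<open>signed_copies\<close>. With absolute values instead of a
  quantified sign vector, membership becomes a single condition on \<open>A\<close>.\<close>

definition signed_points :: "(int ^ 'n) set \<Rightarrow> (int ^ 'n) set" where
  "signed_points A = {a. (\<chi> i. \<bar>a $ i\<bar>) \<in> A}"

lemma shrinks_in:
  assumes "down_closed A" "x \<in> signed_points A" "shrinks x y"
  shows "y \<in> A"
proof (rule down_closedD[OF assms(1), of "\<chi> i. \<bar>x $ i\<bar>"])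
  fix i
  have "0 \<le> y $ i \<and> y $ i \<le> max 0 (x $ i)" using assms(3) by (simp add: shrinks_def)
  then show "0 \<le> y $ i" "y $ i \<le> (\<chi> i. \<bar>x $ i\<bar>) $ i" by auto
qed (use assms(2) in \<open>simp add: signed_points_def\<close>)

text \<open>Pair the two replacements of the same point \<open>x\<close>. Both lie below the
  positive part of \<open>x\<close>, hence so does their componentwise maximum, which is therefore
  in \<open>A\<close>; this is what the coupling lemma asks for.\<close>

lemma connected_by_moves_shrinks:
  fixes M N N' :: "(int ^ 'n) multiset"
  assumes A: "down_closed A" and M: "set_mset M \<subseteq> signed_points A"
    and N: "rel_mset shrinks M N" and N': "rel_mset shrinks M N'" and sum: "\<Sum>\<^sub># N = \<Sum>\<^sub># N'"
  shows "connected_by_moves A N N'"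
proof -
  let ?Q = "\<lambda>y z. (\<forall>i. 0 \<le> y $ i \<and> 0 \<le> z $ i) \<and> (\<chi> i. max (y $ i) (z $ i)) \<in> A"
  have "\<exists>T. N = image_mset fst T \<and> N' = image_mset snd T \<and> (\<forall>(y, z)\<in>#T. ?Q y z)"
    using N N' M
  proof (induction M arbitrary: N N')
    case empty
    then show ?case by auto
  next
    case (add x M)
    from msed_rel_invL[OF add.prems(1)] obtain y N0 where N0: "N = add_mset y N0" "shrinks x y" "rel_mset shrinks M N0"
      by blast
    from msed_rel_invL[OF add.prems(2)] obtain z N1 where N1: "N' = add_mset z N1" "shrinks x z" "rel_mset shrinks M N1"
      by blast
    from add.IH[OF N0(3) N1(3)] add.prems(3) obtain T where
      T: "N0 = image_mset fst T" "N1 = image_mset snd T" "\<forall>(y, z)\<in>#T. ?Q y z" by auto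
    have "\<forall>i. 0 \<le> y $ i \<and> 0 \<le> z $ i" using N0(2) N1(2) by (simp add: shrinks_def)
    moreover have "(\<chi> i. max (y $ i) (z $ i)) \<in> A"
      by (rule shrinks_in[OF A, of x]) (use add.prems(3) N0(2) N1(2) in \<open>simp_all add: shrinks_def max.coboundedI1\<close>)
    ultimately have "N = image_mset fst (add_mset (y, z) T) \<and> N' = image_mset snd (add_mset (y, z) T) \<and>
        (\<forall>(y, z)\<in>#add_mset (y, z) T. ?Q y z)"
      using T N0(1) N1(1) by simp
    then show ?case by (rule exI)
  qed
  then obtain T where T: "N = image_mset fst T" "N' = image_mset snd T" and Q: "\<forall>(y, z)\<in>#T. ?Q y z" by blast
  have "?Q y z" if "(y, z) \<in># T" for y z using Q that by blast
  from connected_by_moves_couple[OF A this sum[unfolded T]] show ?thesis unfolding T .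
qed

text \<open>The Riesz decomposition property of integer vectors: \<open>x\<close> greedily takes as
  much of \<open>t\<close> as \<open>u\<close> allows, and what remains fits under
  \<open>v\<close>.\<close>

lemma split_bounded_sum:
  fixes u v t :: "int ^ 'n"
  assumes "\<And>i. 0 \<le> u $ i" "\<And>i. 0 \<le> v $ i" "\<And>i. 0 \<le> t $ i" "\<And>i. t $ i \<le> u $ i + v $ i"
  obtains x y where "t = x + y" "\<And>i. 0 \<le> x $ i" "\<And>i. x $ i \<le> u $ i" "\<And>i. 0 \<le> y $ i" "\<And>i. y $ i \<le> v $ i"
proof
  let ?x = "\<chi> i. min (t $ i) (u $ i)"
  show "t = ?x + (t - ?x)" by simp
  show "0 \<le> ?x $ i" "?x $ i \<le> u $ i" "0 \<le> (t - ?x) $ i" "(t - ?x) $ i \<le> v $ i" for i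
    using assms[of i] by auto
qed

text \<open>By induction on \<open>M\<close>: \<open>split_bounded_sum\<close> cuts off the share of
  one point, bounded by its positive part, and the remainder is distributed over the other
  points.\<close>

lemma rel_mset_shrinks_exists:
  assumes "\<And>i. 0 \<le> t $ i" and "\<And>i. t $ i \<le> (\<Sum>x\<in>#M. max 0 (x $ i))"
  shows "\<exists>N. rel_mset shrinks M N \<and> \<Sum>\<^sub># N = t"
  using assms
proof (induction M arbitrary: t)
  case empty
  then have "t = 0" by (auto simp: vec_eq_iff intro: antisym)
  then show ?case by (auto simp: rel_mset_Zero)
next
  case (add x M)
  obtain y s where ys: "t = y + s" "\<And>i. 0 \<le> y $ i" "\<And>i. y $ i \<le> (\<chi> i. max 0 (x $ i)) $ i"
    "\<And>i. 0 \<le> s $ i" "\<And>i. s $ i \<le> (\<chi> i. \<Sum>x\<in>#M. max 0 (x $ i)) $ i"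
    using add.prems by (rule_tac split_bounded_sum[of "\<chi> i. max 0 (x $ i)" "\<chi> i. \<Sum>x\<in>#M. max 0 (x $ i)" t])
      (auto simp: sum_mset_nonneg)
  from add.IH[of s] ys obtain N where N: "rel_mset shrinks M N" "\<Sum>\<^sub># N = s" by auto
  have "shrinks x y" using ys by (simp add: shrinks_def)
  then show ?case using N ys(1) by (intro exI[of _ "add_mset y N"]) (auto intro: rel_mset_Plus)
qed

text \<open>One vector \<open>t\<close> lies below the positive parts of \<open>a\<close>,
  \<open>b\<close> taken together and likewise below those of \<open>c\<close>, \<open>d\<close>.
  Splitting \<open>t\<close> in both ways and replacing the untouched rest identically on both sides
  leaves a single move in \<open>A\<close>.\<close>

lemma connected_by_moves_shrinks_move:
  fixes M N :: "(int ^ 'n) multiset"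
  assumes A: "down_closed A" and move: "quadratic_move (signed_points A) M N" and nonneg: "\<And>i. 0 \<le> \<Sum>\<^sub># M $ i"
  shows "\<exists>M' N'. rel_mset shrinks M M' \<and> rel_mset shrinks N N' \<and> \<Sum>\<^sub># M' = \<Sum>\<^sub># M \<and> connected_by_moves A M' N'"
proof -
  from move obtain a b c d R where V: "{a, b, c, d} \<subseteq> signed_points A" and s: "a + b = c + d"
    and M: "M = {#a, b#} + R" and N: "N = {#c, d#} + R"
    unfolding quadratic_move_def by blast
  \<comment> \<open>The common sum of both replaced pairs; the truncation at \<open>\<Sum>\<^sub># M\<close> keeps the remaining sum nonnegative.\<close>
  define t where "t = (\<chi> i. min (\<Sum>\<^sub># M $ i) (max 0 ((a + b) $ i)))"
  have t0: "0 \<le> t $ i" for i using nonneg[of i] by (simp add: t_def)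
  have tab: "t $ i \<le> max 0 (a $ i) + max 0 (b $ i)" for i by (auto simp: t_def)
  have "t $ i \<le> max 0 ((c + d) $ i)" for i unfolding t_def s[symmetric] by simp
  then have tcd: "t $ i \<le> max 0 (c $ i) + max 0 (d $ i)" for i
    by (rule order_trans) auto
  obtain a' b' where ab: "t = a' + b'" "shrinks a a'" "shrinks b b'"
    by (rule split_bounded_sum[of "\<chi> i. max 0 (a $ i)" "\<chi> i. max 0 (b $ i)" t]) (use t0 tab in \<open>auto simp: shrinks_def\<close>)
  obtain c' d' where cd: "t = c' + d'" "shrinks c c'" "shrinks d d'"
    by (rule split_bounded_sum[of "\<chi> i. max 0 (c $ i)" "\<chi> i. max 0 (d $ i)" t]) (use t0 tcd in \<open>auto simp: shrinks_def\<close>)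
  \<comment> \<open>In each coordinate the sum left for \<open>R'\<close> is the maximum of 0 and
    the total sum minus \<open>max 0 ((a + b) $ i)\<close>. The latter is at most the sum of
    \<open>R\<close>, so both are bounded by the sum of the positive parts of
    \<open>R\<close>.\<close>
  have "\<exists>R'. rel_mset shrinks R R' \<and> \<Sum>\<^sub># R' = \<Sum>\<^sub># M - t"
  proof (rule rel_mset_shrinks_exists)
    fix i
    show "0 \<le> (\<Sum>\<^sub># M - t) $ i" by (simp add: t_def)
    have "\<Sum>\<^sub># R $ i \<le> (\<Sum>x\<in>#R. max 0 (x $ i))"
      by (induction R) (auto intro: add_mono)
    moreover have "0 \<le> (\<Sum>x\<in>#R. max 0 (x $ i))"
      by (intro sum_mset_nonneg) auto
    moreover have "\<Sum>\<^sub># M $ i = (a + b) $ i + \<Sum>\<^sub># R $ i" by (simp add: M)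
    ultimately show "(\<Sum>\<^sub># M - t) $ i \<le> (\<Sum>x\<in>#R. max 0 (x $ i))"
      by (simp add: t_def)
  qed
  then obtain R' where R': "rel_mset shrinks R R'" "\<Sum>\<^sub># R' = \<Sum>\<^sub># M - t" by blast
  have "quadratic_move A ({#a', b'#} + R') ({#c', d'#} + R')"
    using V ab cd by (intro quadratic_moveI) (auto intro: shrinks_in[OF A])
  moreover have "rel_mset shrinks M ({#a', b'#} + R')" "rel_mset shrinks N ({#c', d'#} + R')"
    unfolding M N using ab cd R' by (auto intro!: rel_mset_Plus)
  moreover have "\<Sum>\<^sub># ({#a', b'#} + R') = \<Sum>\<^sub># M" using ab R' by (simp flip: add.assoc)
  ultimately show ?thesis by blast
qed

lemma rel_mset_shrinks_refl:
  "(\<And>x i. x \<in># M \<Longrightarrow> 0 \<le> x $ i) \<Longrightarrow> rel_mset shrinks M M"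
  by (intro multiset.rel_refl_strong) (auto simp: shrinks_def)

lemma quadratically_connected_signed_imp:
  fixes A :: "(int ^ 'n) set"
  assumes A: "down_closed A" and pos: "\<And>x i. x \<in> A \<Longrightarrow> 0 \<le> x $ i"
    and conn: "quadratically_connected (signed_points A)"
  shows "quadratically_connected A"
  unfolding quadratically_connected_def
proof (intro allI impI)
  fix M N assume MN: "set_mset M \<subseteq> A" "set_mset N \<subseteq> A" "size M = size N" "\<Sum>\<^sub># M = \<Sum>\<^sub># N"
  have sub: "A \<subseteq> signed_points A"
  proof
    fix x assume "x \<in> A"
    moreover from this have "(\<chi> i. \<bar>x $ i\<bar>) = x" using pos by (simp add: vec_eq_iff)
    ultimately show "x \<in> signed_points A" by (simp add: signed_points_def)
  qed
  have nonneg: "0 \<le> \<Sum>\<^sub># M $ i" for i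
    unfolding sum_mset_nth using MN(1) pos by (intro sum_mset_nonneg) auto
  have "connected_by_moves (signed_points A) M N"
    using conn MN sub unfolding quadratically_connected_def by blast
  \<comment> \<open>Invariant along the path: some replacement of the current multiset has the
    original sum and is reached from \<open>M\<close> inside \<open>A\<close>. At the start
    \<open>M\<close> replaces itself, being nonnegative.\<close>
  then have "\<exists>N'. rel_mset shrinks N N' \<and> \<Sum>\<^sub># N' = \<Sum>\<^sub># M \<and> connected_by_moves A M N'"
  proof (induction rule: rtranclp_induct)
    case base
    then show ?case using rel_mset_shrinks_refl[of M] MN(1) pos by blast
  next
    case (step L N)
    note inv = connected_by_moves_invariants[OF step.hyps(1)]
    have "set_mset L \<subseteq> signed_points A" using inv(3) MN(1) sub by blast
    from step.IH obtain L' where L': "rel_mset shrinks L L'" "\<Sum>\<^sub># L' = \<Sum>\<^sub># M" "connected_by_moves A M L'" by blast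
    from connected_by_moves_shrinks_move[OF A step.hyps(2)] nonneg inv(2) obtain L'' N' where
      *: "rel_mset shrinks L L''" "rel_mset shrinks N N'" "\<Sum>\<^sub># L'' = \<Sum>\<^sub># L" "connected_by_moves A L'' N'"
      by metis
    \<comment> \<open>Two replacements of \<open>L\<close> meet here: the one reached so far and the
      one adapted to the next move. Their sums agree, so they are connected.\<close>
    have "connected_by_moves A L' L''"
      by (rule connected_by_moves_shrinks[OF A \<open>set_mset L \<subseteq> signed_points A\<close> L'(1) *(1)]) (simp add: * L' inv)
    moreover have "\<Sum>\<^sub># N' = \<Sum>\<^sub># M" using connected_by_moves_invariants(2)[OF *(4)] * inv by simp
    ultimately show ?case using L'(3) * by (meson rtranclp_trans)
  qed
  then obtain N' where N': "rel_mset shrinks N N'" "\<Sum>\<^sub># N' = \<Sum>\<^sub># M" "connected_by_moves A M N'" by blast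
  \<comment> \<open>The path ends at some replacement of \<open>N\<close>; since \<open>N\<close> is
    a replacement of itself with the same sum, a final path leads to \<open>N\<close>.\<close>
  have "rel_mset shrinks N N" using rel_mset_shrinks_refl[of N] MN(2) pos by blast
  then have "connected_by_moves A N' N"
    using connected_by_moves_shrinks[OF A _ N'(1)] MN sub N'(2) by auto
  with N'(3) show "connected_by_moves A M N" by (meson rtranclp_trans)
qed

section \<open>From nonnegative points to signed points\<close>

lemma connected_to_single_orthant:
  fixes M :: "(int ^ 'n) multiset"
  assumes A: "down_closed A" and M: "set_mset M \<subseteq> signed_points A"
  shows "\<exists>N. connected_by_moves (signed_points A) M N \<and>
    (\<forall>i. (\<forall>x\<in>#N. 0 \<le> x $ i) \<or> (\<forall>x\<in>#N. x $ i \<le> 0))"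
  using M
proof (induction "\<Sum>x\<in>#M. (\<Sum>i\<in>UNIV. nat \<bar>x $ i\<bar>)" arbitrary: M rule: less_induct)
  case less
  show ?case
  proof (cases "\<forall>i. (\<forall>x\<in>#M. 0 \<le> x $ i) \<or> (\<forall>x\<in>#M. x $ i \<le> 0)")
    case False
    then obtain i a b where ab: "a \<in># M" "0 < a $ i" "b \<in># M" "b $ i < 0" by (auto simp: not_le)
    then obtain M1 where M1: "M = add_mset a M1" by (metis mset_add)
    with ab have "b \<in># M1" by auto
    then obtain R where "M1 = add_mset b R" by (metis mset_add)
    with M1 have R: "M = {#a, b#} + R" by simp
    \<comment> \<open>As \<open>a $ i\<close> is at least 1 and \<open>b $ i\<close> at most -1,
      both entries step towards zero without crossing it. So the new points stay in
      \<open>signed_points A\<close> and the total of absolute values decreases.\<close>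
    define c where "c = a - axis i 1"
    define d where "d = b + axis i 1"
    have comp: "c $ j = (if j = i then a $ j - 1 else a $ j)"
      "d $ j = (if j = i then b $ j + 1 else b $ j)" for j
      by (auto simp: c_def d_def axis_def)
    have smaller: "x \<in> signed_points A" if "y \<in> signed_points A" "\<And>j. \<bar>x $ j\<bar> \<le> \<bar>y $ j\<bar>" for x y
      unfolding signed_points_def mem_Collect_eq
      by (rule down_closedD[OF A, of "\<chi> j. \<bar>y $ j\<bar>"]) (use that in \<open>auto simp: signed_points_def\<close>)
    have in_ab: "a \<in> signed_points A" "b \<in> signed_points A" using less.prems R by auto
    have in_cd: "c \<in> signed_points A" "d \<in> signed_points A"
      by (rule smaller[OF in_ab(1)], use ab in \<open>auto simp: comp\<close>)
         (rule smaller[OF in_ab(2)], use ab in \<open>auto simp: comp\<close>)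
    have "a + b = c + d" by (simp add: c_def d_def)
    then have move: "quadratic_move (signed_points A) M ({#c, d#} + R)"
      unfolding R using in_ab in_cd by (intro quadratic_moveI)
    have "(\<Sum>j\<in>UNIV. nat \<bar>c $ j\<bar>) < (\<Sum>j\<in>UNIV. nat \<bar>a $ j\<bar>)"
      by (rule sum_strict_mono_ex1; use ab in \<open>auto simp: comp\<close>)
    moreover have "(\<Sum>j\<in>UNIV. nat \<bar>d $ j\<bar>) < (\<Sum>j\<in>UNIV. nat \<bar>b $ j\<bar>)"
      by (rule sum_strict_mono_ex1; use ab in \<open>auto simp: comp\<close>)
    ultimately have "(\<Sum>x\<in>#{#c, d#} + R. (\<Sum>i\<in>UNIV. nat \<bar>x $ i\<bar>)) < (\<Sum>x\<in>#M. (\<Sum>i\<in>UNIV. nat \<bar>x $ i\<bar>))"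
      by (simp add: R)
    moreover have "set_mset ({#c, d#} + R) \<subseteq> signed_points A" using in_cd less.prems R by auto
    ultimately show ?thesis using less.hyps move by (meson converse_rtranclp_into_rtranclp)
  qed auto
qed

text \<open>If the entries share a sign that disagrees with the sign of their sum, all of them
  vanish. Hence the sum alone determines an orthant that contains the multiset.\<close>

lemma sum_mset_sign:
  fixes M :: "(int ^ 'n) multiset"
  assumes "(\<forall>x\<in>#M. 0 \<le> x $ i) \<or> (\<forall>x\<in>#M. x $ i \<le> 0)" and "x \<in># M"
  shows "0 \<le> \<Sum>\<^sub># M $ i \<Longrightarrow> 0 \<le> x $ i" and "\<Sum>\<^sub># M $ i \<le> 0 \<Longrightarrow> x $ i \<le> 0"
proof -
  obtain R where R: "M = add_mset x R" using assms(2) by (metis mset_add)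
  have "(\<forall>x\<in>#R. 0 \<le> x $ i) \<Longrightarrow> 0 \<le> \<Sum>\<^sub># R $ i" "(\<forall>x\<in>#R. x $ i \<le> 0) \<Longrightarrow> \<Sum>\<^sub># R $ i \<le> 0"
    by (induction R) auto
  with assms(1) show "0 \<le> \<Sum>\<^sub># M $ i \<Longrightarrow> 0 \<le> x $ i" and "\<Sum>\<^sub># M $ i \<le> 0 \<Longrightarrow> x $ i \<le> 0"
    unfolding R by auto
qed

lemma quadratically_connected_imp_signed:
  fixes A :: "(int ^ 'n) set"
  assumes A: "down_closed A" and conn: "quadratically_connected A" and pos: "\<And>x i. x \<in> A \<Longrightarrow> 0 \<le> x $ i"
  shows "quadratically_connected (signed_points A)"
  unfolding quadratically_connected_def
proof (intro allI impI)
  fix M N assume MN: "set_mset M \<subseteq> signed_points A" "set_mset N \<subseteq> signed_points A" "size M = size N" "\<Sum>\<^sub># M = \<Sum>\<^sub># N"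
  obtain M' where M': "connected_by_moves (signed_points A) M M'"
    "\<And>i. (\<forall>x\<in>#M'. 0 \<le> x $ i) \<or> (\<forall>x\<in>#M'. x $ i \<le> 0)"
    using connected_to_single_orthant[OF A MN(1)] by blast
  obtain N' where N': "connected_by_moves (signed_points A) N N'"
    "\<And>i. (\<forall>x\<in>#N'. 0 \<le> x $ i) \<or> (\<forall>x\<in>#N'. x $ i \<le> 0)"
    using connected_to_single_orthant[OF A MN(2)] by blast
  note invM = connected_by_moves_invariants[OF M'(1)] and invN = connected_by_moves_invariants[OF N'(1)]
  \<comment> \<open>Signs of the common sum. Where the sum is 0 the value 1 is harmless, since
    \<open>sum_mset_sign\<close> forces all entries of \<open>M'\<close> and \<open>N'\<close> to
    vanish there.\<close>
  define \<epsilon> where "\<epsilon> i = (if 0 \<le> \<Sum>\<^sub># M $ i then 1 else - 1 :: int)" for i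
  define f where "f x = (\<chi> i. \<epsilon> i * x $ i)" for x :: "int ^ 'n"
  have eps: "\<epsilon> i * (\<epsilon> i * k) = k" "\<bar>\<epsilon> i * k\<bar> = \<bar>k\<bar>" for i k by (auto simp: \<epsilon>_def)
  have ff: "f (f x) = x" for x by (simp add: f_def vec_eq_iff eps)
  have f_add: "f (x + y) = f x + f y" for x y by (simp add: f_def vec_eq_iff distrib_left)
  \<comment> \<open>\<open>M'\<close> and \<open>N'\<close> lie in the orthant of their common sum,
    so on their points the reflection \<open>f\<close> takes absolute values and lands in
    \<open>A\<close>.\<close>
  have f_signed: "f x = (\<chi> i. \<bar>x $ i\<bar>)" if "x \<in># M' \<or> x \<in># N'" for x
    unfolding f_def vec_eq_iff
  proof
    fix i
    have "(0 \<le> \<Sum>\<^sub># M $ i \<longrightarrow> 0 \<le> x $ i) \<and> (\<Sum>\<^sub># M $ i \<le> 0 \<longrightarrow> x $ i \<le> 0)"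
      using that sum_mset_sign[OF M'(2), of x] sum_mset_sign[OF N'(2), of x] invM invN MN(4) by metis
    then show "(\<chi> i. \<epsilon> i * x $ i) $ i = (\<chi> i. \<bar>x $ i\<bar>) $ i" by (auto simp: \<epsilon>_def)
  qed
  have sub: "set_mset (image_mset f M') \<subseteq> A" "set_mset (image_mset f N') \<subseteq> A"
    using invM(3)[OF MN(1)] invN(3)[OF MN(2)] f_signed by (auto simp: signed_points_def subset_iff)
  have "\<Sum>\<^sub># (image_mset f K) = f (\<Sum>\<^sub># K)" for K
    by (induction K) (auto simp: f_add f_def vec_eq_iff distrib_left)
  then have "connected_by_moves A (image_mset f M') (image_mset f N')"
    using conn sub invM invN MN(3,4) unfolding quadratically_connected_def by simp
  \<comment> \<open>The path found in \<open>A\<close> is reflected back; \<open>f\<close> is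
    additive and an involution, so it preserves moves and restores \<open>M'\<close> and
    \<open>N'\<close>.\<close>
  then have "connected_by_moves (signed_points A) (image_mset f (image_mset f M')) (image_mset f (image_mset f N'))"
  proof (rule connected_by_moves_image[where V = A and f = f, OF _ f_add])
    have "(\<chi> i. \<bar>f x $ i\<bar>) = x" if "x \<in> A" for x using pos[OF that] by (simp add: f_def vec_eq_iff eps)
    then show "f ` A \<subseteq> signed_points A" by (auto simp: signed_points_def)
  qed
  then have "connected_by_moves (signed_points A) M' N'" by (simp add: multiset.map_comp comp_def ff)
  then show "connected_by_moves (signed_points A) M N"
    using M'(1) connected_by_moves_sym[OF N'(1)] by (meson rtranclp_trans)
qed

section \<open>Ideals of congruences on monomials\<close>

lemma poly_ring_simps [simp]:
  "p \<in> carrier (poly_ring V) \<longleftrightarrow> (\<forall>m\<in>Poly_Mapping.keys p. Poly_Mapping.keys m \<subseteq> V)"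
  "mult (poly_ring V) = (*)" "one (poly_ring V) = 1" "zero (poly_ring V) = 0" "add (poly_ring V) = (+)"
  by (simp_all add: poly_ring_def)

lemma poly_ring_mult_closed:
  fixes p q :: "('v, 'k::field) mpoly"
  assumes "p \<in> carrier (poly_ring V)" "q \<in> carrier (poly_ring V)"
  shows "p * q \<in> carrier (poly_ring V)"
  unfolding poly_ring_simps
proof
  fix m assume "m \<in> Poly_Mapping.keys (p * q)"
  then obtain a b where "m = a + b" "a \<in> Poly_Mapping.keys p" "b \<in> Poly_Mapping.keys q"
    using keys_mult by blast
  then show "Poly_Mapping.keys m \<subseteq> V"
    using assms keys_add[of a b] unfolding poly_ring_simps by blast
qed

lemma poly_ring_add_closed:
  fixes p q :: "('v, 'k::field) mpoly"
  assumes "p \<in> carrier (poly_ring V)" "q \<in> carrier (poly_ring V)"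
  shows "p + q \<in> carrier (poly_ring V)"
  using assms keys_add[of p q] unfolding poly_ring_simps by blast

lemma cring_poly_ring: "cring (poly_ring V :: ('v, 'k::field) mpoly ring)" (is "cring ?R")
proof (rule cringI)
  show "abelian_group ?R"
  proof (rule abelian_groupI)
    fix x assume "x \<in> carrier ?R"
    then show "\<exists>y\<in>carrier ?R. y \<oplus>\<^bsub>?R\<^esub> x = \<zero>\<^bsub>?R\<^esub>"
      by (intro bexI[of _ "- x"]) auto
  next
    fix x y assume "x \<in> carrier ?R" "y \<in> carrier ?R"
    then show "x \<oplus>\<^bsub>?R\<^esub> y \<in> carrier ?R" unfolding poly_ring_simps(5) by (rule poly_ring_add_closed)
  qed (auto simp: add.assoc add.commute)
  show "comm_monoid ?R"
  proof (rule comm_monoidI)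
    fix x y assume "x \<in> carrier ?R" "y \<in> carrier ?R"
    then show "x \<otimes>\<^bsub>?R\<^esub> y \<in> carrier ?R" unfolding poly_ring_simps(2) by (rule poly_ring_mult_closed)
  qed (auto simp: mult.assoc mult.commute)
qed (auto simp: distrib_right)

lemma poly_ring_ideal_closed:
  fixes J :: "('v, 'k::field) mpoly set"
  assumes "ideal J (poly_ring V)"
  shows "0 \<in> J" and "\<lbrakk>p \<in> J; q \<in> J\<rbrakk> \<Longrightarrow> p + q \<in> J"
    and "\<lbrakk>p \<in> J; r \<in> carrier (poly_ring V)\<rbrakk> \<Longrightarrow> r * p \<in> J"
  using additive_subgroup.zero_closed[OF ideal.axioms(1)[OF assms]]
    additive_subgroup.a_closed[OF ideal.axioms(1)[OF assms], of p q]
    ideal.I_l_closed[OF assms, of p r]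
  unfolding poly_ring_simps(2,4,5) by blast+

section \<open>Coefficient sums and the ideal of a congruence\<close>

definition class_sum :: "'m set \<Rightarrow> ('m \<Rightarrow>\<^sub>0 'k::field) \<Rightarrow> 'k" where
  "class_sum C p = (\<Sum>m\<in>Poly_Mapping.keys p \<inter> C. Poly_Mapping.lookup p m)"

lemma class_sum_superset:
  assumes "finite S" "Poly_Mapping.keys p \<subseteq> S"
  shows "class_sum C p = (\<Sum>m\<in>S \<inter> C. Poly_Mapping.lookup p m)"
  unfolding class_sum_def using assms
  by (intro sum.mono_neutral_left) (auto simp: in_keys_iff)

lemma class_sum_zero [simp]: "class_sum C 0 = 0"
  by (simp add: class_sum_def)

lemma class_sum_add: "class_sum C (p + q) = class_sum C p + class_sum C q"
proof -
  let ?S = "Poly_Mapping.keys p \<union> Poly_Mapping.keys q"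
  have "class_sum C r = (\<Sum>m\<in>?S \<inter> C. Poly_Mapping.lookup r m)" if "Poly_Mapping.keys r \<subseteq> ?S" for r
    by (rule class_sum_superset) (use that in auto)
  from this[of p] this[of q] this[of "p + q"] show ?thesis
    using keys_add[of p q] by (simp add: lookup_add sum.distrib)
qed

lemma class_sum_uminus: "class_sum C (- p) = - class_sum C p"
  by (simp add: class_sum_def sum_negf)

lemma class_sum_diff: "class_sum C (p - q) = class_sum C p - class_sum C q"
  using class_sum_add[of C p "- q"] by (simp add: class_sum_uminus)

lemma class_sum_sum: "class_sum C (\<Sum>i\<in>I. f i) = (\<Sum>i\<in>I. class_sum C (f i))"
  by (induction I rule: infinite_finite_induct) (auto simp: class_sum_add)

lemma class_sum_single: "class_sum C (Poly_Mapping.single m c) = (if m \<in> C then c else 0)"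
  by (simp add: class_sum_superset[of "{m}"] )

lemma poly_mapping_sum_single:
  "p = (\<Sum>m\<in>Poly_Mapping.keys p. Poly_Mapping.single m (Poly_Mapping.lookup p m))"
  by (rule poly_mapping_eqI) (simp add: lookup_sum lookup_single when_def in_keys_iff)

text \<open>Multiplication by a monomial shifts exponents, so summing over \<open>C\<close> amounts
  to summing over the preimage of \<open>C\<close> under that shift. This gives absorption in
  \<open>ideal_congruence_ideal\<close>.\<close>

lemma class_sum_times_single:
  fixes p :: "'m::monoid_add \<Rightarrow>\<^sub>0 'k::field"
  shows "class_sum C (Poly_Mapping.single w c * p) = c * class_sum {m. w + m \<in> C} p"
proof -
  have "class_sum C (Poly_Mapping.single w c * p) =
      (\<Sum>m\<in>Poly_Mapping.keys p. c * class_sum {m. w + m \<in> C} (Poly_Mapping.single m (Poly_Mapping.lookup p m)))"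
    by (subst poly_mapping_sum_single[of p])
      (simp add: sum_distrib_left class_sum_sum mult_single class_sum_single if_distrib cong: if_cong)
  also have "\<dots> = c * class_sum {m. w + m \<in> C} p"
    by (subst (2) poly_mapping_sum_single[of p]) (simp add: class_sum_sum sum_distrib_left)
  finally show ?thesis .
qed

text \<open>
  Coefficient sums are required to vanish on all \<open>E\<close>-closed sets, not only on the classes of \<open>E\<close>:
  closed sets, unlike classes, are preserved under preimages by multiplication with a monomial.
\<close>

definition congruence_ideal ::
    "'v set \<Rightarrow> (('v \<Rightarrow>\<^sub>0 nat) \<Rightarrow> ('v \<Rightarrow>\<^sub>0 nat) \<Rightarrow> bool) \<Rightarrow> ('v, 'k::field) mpoly set" where
  "congruence_ideal V E =
     {p \<in> carrier (poly_ring V). \<forall>C. (\<forall>u v. E u v \<longrightarrow> (u \<in> C \<longleftrightarrow> v \<in> C)) \<longrightarrow> class_sum C p = 0}"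

lemma congruence_ideal_class_sum:
  "\<lbrakk>p \<in> congruence_ideal V E; \<And>u v. E u v \<Longrightarrow> u \<in> C \<longleftrightarrow> v \<in> C\<rbrakk> \<Longrightarrow> class_sum C p = 0"
  by (simp add: congruence_ideal_def)

lemma ideal_congruence_ideal:
  assumes E: "\<And>u v w. E u v \<Longrightarrow> E (w + u) (w + v)"
  shows "ideal (congruence_ideal V E) (poly_ring V :: ('v, 'k::field) mpoly ring)" (is "ideal ?I ?R")
proof -
  interpret cring ?R by (rule cring_poly_ring)
  have mult: "x * a \<in> ?I" if "a \<in> ?I" "x \<in> carrier ?R" for a x
  proof -
    have "class_sum C (x * a) = 0" if C: "\<forall>u v. E u v \<longrightarrow> (u \<in> C \<longleftrightarrow> v \<in> C)" for C
    proof -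
      \<comment> \<open>Compatibility of \<open>E\<close> with adding \<open>w\<close> makes the
        preimage of \<open>C\<close> closed again.\<close>
      have "class_sum {m. w + m \<in> C} a = 0" for w
      proof (rule congruence_ideal_class_sum[OF \<open>a \<in> ?I\<close>])
        fix u v assume "E u v"
        with C E[of u v w] show "u \<in> {m. w + m \<in> C} \<longleftrightarrow> v \<in> {m. w + m \<in> C}" by auto
      qed
      then show ?thesis
        by (subst poly_mapping_sum_single[of x]) (simp add: sum_distrib_right class_sum_sum class_sum_times_single)
    qed
    moreover have "x * a \<in> carrier ?R"
      using that by (intro poly_ring_mult_closed) (auto simp: congruence_ideal_def)
    ultimately show ?thesis unfolding congruence_ideal_def by blast
  qed
  show ?thesis
  proof (rule idealI)
    show "ring ?R" by (rule ring_axioms)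
    show "subgroup ?I (add_monoid ?R)"
    proof (rule add.subgroupI)
      show "?I \<noteq> {}" by (auto simp: congruence_ideal_def intro!: exI[of _ 0])
    next
      fix a assume a: "a \<in> ?I"
      \<comment> \<open>Uniqueness of inverses identifies the negation of the ring record with that
        of the type.\<close>
      have "- a \<oplus>\<^bsub>?R\<^esub> a = \<zero>\<^bsub>?R\<^esub>" by simp
      moreover have "a \<in> carrier ?R" "- a \<in> carrier ?R" using a by (auto simp: congruence_ideal_def)
      ultimately have "\<ominus>\<^bsub>?R\<^esub> a = - a" using minus_equality by blast
      then show "\<ominus>\<^bsub>?R\<^esub> a \<in> ?I" using a by (auto simp: congruence_ideal_def class_sum_uminus)
    next
      fix a b assume "a \<in> ?I" "b \<in> ?I"
      then show "a \<oplus>\<^bsub>?R\<^esub> b \<in> ?I"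
        using poly_ring_add_closed[of a V b] by (auto simp: congruence_ideal_def class_sum_add)
    qed (auto simp: congruence_ideal_def)
  qed (use mult in \<open>auto simp: mult.commute\<close>)
qed

text \<open>The coefficients 1 and -1 cancel over \<open>C\<close> exactly when \<open>C\<close>
  contains both monomials or neither. The class of \<open>u\<close> is itself closed, and it
  separates \<open>u\<close> from \<open>v\<close> unless they are related.\<close>

lemma binomial_in_congruence_ideal_iff:
  assumes "equivp E" "Poly_Mapping.keys u \<subseteq> V" "Poly_Mapping.keys v \<subseteq> V"
  shows "(Poly_Mapping.single u 1 - Poly_Mapping.single v 1 :: ('v, 'k::field) mpoly) \<in> congruence_ideal V E \<longleftrightarrow> E u v"
proof -
  have "Poly_Mapping.single u 1 - Poly_Mapping.single v 1 \<in> carrier (poly_ring V :: ('v, 'k) mpoly ring)"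
    using assms(2,3) keys_diff[of "Poly_Mapping.single u 1" "Poly_Mapping.single v (1 :: 'k)"] by auto
  moreover have "class_sum C (Poly_Mapping.single u 1 - Poly_Mapping.single v 1 :: ('v, 'k) mpoly) = 0 \<longleftrightarrow>
      (u \<in> C \<longleftrightarrow> v \<in> C)" for C
    by (auto simp: class_sum_diff class_sum_single)
  ultimately have *: "(Poly_Mapping.single u 1 - Poly_Mapping.single v 1 :: ('v, 'k::field) mpoly) \<in> congruence_ideal V E \<longleftrightarrow>
      (\<forall>C. (\<forall>u v. E u v \<longrightarrow> (u \<in> C \<longleftrightarrow> v \<in> C)) \<longrightarrow> (u \<in> C \<longleftrightarrow> v \<in> C))"
    unfolding congruence_ideal_def by blast
  have "E a b \<longrightarrow> (a \<in> Collect (E u) \<longleftrightarrow> b \<in> Collect (E u))" for a b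
    using equivp_transp[OF assms(1)] equivp_symp[OF assms(1)] by blast
  moreover have "E u u" using equivp_reflp[OF assms(1)] .
  ultimately show ?thesis unfolding * by blast
qed

text \<open>Elimination by induction on the size of the support: subtracting a scalar multiple of a
  binomial of related monomials removes one monomial of \<open>p\<close> and creates none.\<close>

lemma congruence_ideal_subset:
  fixes J :: "('v, 'k::field) mpoly set"
  assumes E: "equivp E" and J: "ideal J (poly_ring V)"
    and bin: "\<And>u v. \<lbrakk>E u v; Poly_Mapping.keys u \<subseteq> V; Poly_Mapping.keys v \<subseteq> V\<rbrakk>
      \<Longrightarrow> Poly_Mapping.single u 1 - Poly_Mapping.single v 1 \<in> J"
  shows "congruence_ideal V E \<subseteq> J"
proof
  fix p :: "('v, 'k) mpoly"
  assume "p \<in> congruence_ideal V E"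
  then show "p \<in> J"
  proof (induction "card (Poly_Mapping.keys p)" arbitrary: p rule: less_induct)
    case less
    show ?case
    proof (cases "p = 0")
      case True
      then show ?thesis using poly_ring_ideal_closed(1)[OF J] by simp
    next
      case False
      then obtain m where m: "m \<in> Poly_Mapping.keys p" by (metis all_not_in_conv keys_eq_empty)
      let ?c = "Poly_Mapping.lookup p m"
      have supp: "Poly_Mapping.keys u \<subseteq> V" if "u \<in> Poly_Mapping.keys p" for u
        using less.prems that by (auto simp: congruence_ideal_def)
      have cl: "\<forall>u v. E u v \<longrightarrow> (u \<in> Collect (E m) \<longleftrightarrow> v \<in> Collect (E m))"
        using equivp_transp[OF E] equivp_symp[OF E] by blast
      have "m \<in> Collect (E m)" using equivp_reflp[OF E] by blast
      \<comment> \<open>The coefficients over the class of \<open>m\<close> sum to zero while that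
        of \<open>m\<close> is nonzero, so a second monomial of \<open>p\<close> lies in this
        class.\<close>
      have "\<exists>m'\<in>Poly_Mapping.keys p. E m m' \<and> m' \<noteq> m"
      proof (rule ccontr)
        assume "\<not> ?thesis"
        then have "Poly_Mapping.keys p \<inter> Collect (E m) = {m}" using m \<open>m \<in> Collect (E m)\<close> by auto
        then have "class_sum (Collect (E m)) p = ?c" by (simp add: class_sum_def)
        moreover have "class_sum (Collect (E m)) p = 0"
          using less.prems cl unfolding congruence_ideal_def by blast
        ultimately show False using m by (simp add: in_keys_iff)
      qed
      then obtain m' where m': "m' \<in> Poly_Mapping.keys p" "E m m'" "m' \<noteq> m" by blast
      define b :: "('v, 'k) mpoly" where "b = Poly_Mapping.single m 1 - Poly_Mapping.single m' 1"
      define q where "q = Poly_Mapping.single 0 ?c * b"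
      have q: "q = Poly_Mapping.single m ?c - Poly_Mapping.single m' ?c"
        by (simp add: q_def b_def right_diff_distrib mult_single)
      have c: "Poly_Mapping.single 0 ?c \<in> carrier (poly_ring V :: ('v, 'k) mpoly ring)" by simp
      have b_J: "b \<in> J" unfolding b_def by (rule bin[OF m'(2) supp[OF m] supp[OF m'(1)]])
      have "q \<in> J" unfolding q_def by (rule poly_ring_ideal_closed(3)[OF J b_J c])
      \<comment> \<open>The coefficient of \<open>m\<close> cancels, and \<open>m'\<close> already
        belonged to the support.\<close>
      have keys: "Poly_Mapping.keys (p - q) \<subseteq> Poly_Mapping.keys p - {m}"
        using m m'(1,3) by (auto simp: q in_keys_iff lookup_minus lookup_single when_def split: if_splits)
      have "p - q \<in> congruence_ideal V E"
        unfolding congruence_ideal_def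
      proof (intro CollectI conjI allI impI)
        show "p - q \<in> carrier (poly_ring V)" using keys supp by auto
        fix C assume C: "\<forall>u v. E u v \<longrightarrow> (u \<in> C \<longleftrightarrow> v \<in> C)"
        then have "class_sum C p = 0" using less.prems unfolding congruence_ideal_def by blast
        moreover have "m \<in> C \<longleftrightarrow> m' \<in> C" using C m'(2) by blast
        ultimately show "class_sum C (p - q) = 0" by (simp add: class_sum_diff q class_sum_single)
      qed
      moreover have "card (Poly_Mapping.keys (p - q)) < card (Poly_Mapping.keys p)"
        using keys m by (intro psubset_card_mono) auto
      ultimately have "p - q \<in> J" using less.hyps by blast
      then have "(p - q) + q \<in> J" using poly_ring_ideal_closed(2)[OF J _ \<open>q \<in> J\<close>] by blast
      then show ?thesis by simp
    qed
  qed
qed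

section \<open>Toric ideals\<close>

definition mset_of_monomial :: "('v \<Rightarrow>\<^sub>0 nat) \<Rightarrow> 'v multiset" where
  "mset_of_monomial m = Abs_multiset (Poly_Mapping.lookup m)"

lemma count_mset_of_monomial [simp]: "count (mset_of_monomial m) v = Poly_Mapping.lookup m v"
proof -
  have "finite {v. 0 < Poly_Mapping.lookup m v}" using finite_lookup[of m] by simp
  then show ?thesis by (simp add: mset_of_monomial_def count_Abs_multiset)
qed

lemma set_mset_of_monomial [simp]: "set_mset (mset_of_monomial m) = Poly_Mapping.keys m"
  by (auto simp: set_mset_def in_keys_iff)

lemma mset_of_monomial_add [simp]: "mset_of_monomial (u + v) = mset_of_monomial u + mset_of_monomial v"
  by (rule multiset_eqI) (simp add: lookup_add)

lemma mset_of_monomial_eq_iff [simp]: "mset_of_monomial u = mset_of_monomial v \<longleftrightarrow> u = v"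
  by (metis count_mset_of_monomial poly_mapping_eqI)

lemma mset_of_monomial_surj: obtains m where "mset_of_monomial m = M"
proof
  show "mset_of_monomial (Poly_Mapping.Abs_poly_mapping (count M)) = M"
    by (rule multiset_eqI) (simp add: Abs_poly_mapping_inverse)
qed

lemma monomial_degree_eq_size: "monomial_degree m = size (mset_of_monomial m)"
  by (simp add: monomial_degree_def size_multiset_overloaded_eq)

text \<open>The exponent of the image of \<open>m\<close> in the Laurent ring: the exponent of t is
  the sum of the lattice points, that of s is the degree.\<close>

definition weight :: "('v::comm_monoid_add \<Rightarrow>\<^sub>0 nat) \<Rightarrow> 'v \<times> nat" where
  "weight m = (\<Sum>\<^sub># (mset_of_monomial m), size (mset_of_monomial m))"

lemma weight_add: "weight (u + v) = weight u + weight v"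
  by (simp add: weight_def)

lemma toric_hom_eq:
  fixes p :: "(int ^ 'n::finite, 'k::field) mpoly"
  shows "toric_hom p = (\<Sum>m\<in>Poly_Mapping.keys p. Poly_Mapping.single (weight m) (Poly_Mapping.lookup p m))"
proof -
  have single_0: "Poly_Mapping.single (0, 0) 1 = (1 :: ('n, 'k) laurent)"
    unfolding zero_prod_def[symmetric] by (rule single_one)
  have prod_mset: "(\<Prod>a\<in>#M. toric_monomial a :: ('n, 'k) laurent) = Poly_Mapping.single (\<Sum>\<^sub># M, size M) 1" for M
    by (induction M) (auto simp: toric_monomial_def mult_single single_0)
  have "(\<Prod>a\<in>Poly_Mapping.keys m. toric_monomial a ^ Poly_Mapping.lookup m a) =
      (Poly_Mapping.single (weight m) 1 :: ('n, 'k) laurent)" for m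
    using image_prod_mset_multiplicity[of "toric_monomial :: _ \<Rightarrow> ('n, 'k) laurent" "mset_of_monomial m"]
    by (simp add: prod_mset weight_def)
  then show ?thesis by (simp add: toric_hom_def mult_single flip: zero_prod_def)
qed

text \<open>The coefficient of \<open>toric_hom p\<close> at \<open>d\<close> is the coefficient sum
  of \<open>p\<close> over the fibre of \<open>weight\<close> at \<open>d\<close>. Fibres are
  closed, and every closed set is a union of fibres.\<close>

lemma toric_ideal_eq_congruence_ideal:
  "(toric_ideal Q :: (int ^ 'n::finite, 'k::field) mpoly set) =
     congruence_ideal (lattice_points Q) (\<lambda>u v. weight u = weight v)"
proof -
  have zero_iff: "toric_hom p = 0 \<longleftrightarrow>
      (\<forall>C. (\<forall>u v. weight u = weight v \<longrightarrow> (u \<in> C \<longleftrightarrow> v \<in> C)) \<longrightarrow> class_sum C p = 0)"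
    for p :: "(int ^ 'n, 'k) mpoly"
  proof
    assume 0: "toric_hom p = 0"
    have fibre: "(\<Sum>m\<in>{m \<in> Poly_Mapping.keys p. weight m = d}. Poly_Mapping.lookup p m) = 0" for d
    proof -
      have "Poly_Mapping.lookup (toric_hom p) d =
          (\<Sum>m\<in>{m \<in> Poly_Mapping.keys p. weight m = d}. Poly_Mapping.lookup p m)"
        unfolding toric_hom_eq by (simp add: lookup_sum lookup_single when_def sum.If_cases Int_def)
      then show ?thesis by (simp add: 0)
    qed
    show "\<forall>C. (\<forall>u v. weight u = weight v \<longrightarrow> (u \<in> C \<longleftrightarrow> v \<in> C)) \<longrightarrow> class_sum C p = 0"
    proof (intro allI impI)
      fix C :: "(int ^ 'n \<Rightarrow>\<^sub>0 nat) set"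
      assume C: "\<forall>u v. weight u = weight v \<longrightarrow> (u \<in> C \<longleftrightarrow> v \<in> C)"
      let ?K = "Poly_Mapping.keys p \<inter> C"
      have "class_sum C p = (\<Sum>d\<in>weight ` ?K. \<Sum>m\<in>{m \<in> ?K. weight m = d}. Poly_Mapping.lookup p m)"
        unfolding class_sum_def by (rule sum.image_gen) simp
      \<comment> \<open>A fibre that meets \<open>C\<close> lies entirely in \<open>C\<close>, so
        intersecting it with \<open>C\<close> does not change the inner sum.\<close>
      also have "\<dots> = (\<Sum>d\<in>weight ` ?K. \<Sum>m\<in>{m \<in> Poly_Mapping.keys p. weight m = d}. Poly_Mapping.lookup p m)"
      proof (intro sum.cong refl)
        fix d assume "d \<in> weight ` ?K"
        then obtain m0 where "m0 \<in> C" "d = weight m0" by blast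
        then have "m \<in> C" if "weight m = d" for m using C that by metis
        then show "{m \<in> ?K. weight m = d} = {m \<in> Poly_Mapping.keys p. weight m = d}" by blast
      qed
      also have "\<dots> = 0" by (simp add: fibre)
      finally show "class_sum C p = 0" .
    qed
  next
    assume *: "\<forall>C. (\<forall>u v. weight u = weight v \<longrightarrow> (u \<in> C \<longleftrightarrow> v \<in> C)) \<longrightarrow> class_sum C p = 0"
    show "toric_hom p = 0"
    proof (rule poly_mapping_eqI)
      fix d
      have "class_sum {m. weight m = d} p = 0" using * by auto
      moreover have "Poly_Mapping.lookup (toric_hom p) d = class_sum {m. weight m = d} p"
        unfolding toric_hom_eq class_sum_def
        by (simp add: lookup_sum lookup_single when_def sum.If_cases Int_def)
      ultimately show "Poly_Mapping.lookup (toric_hom p) d = Poly_Mapping.lookup 0 d" by simp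
    qed
  qed
  have "zero (toric_ring Q :: ('n, 'k) laurent ring) = 0"
    by (simp add: toric_ring_def laurent_ring_def)
  then show ?thesis
    unfolding toric_ideal_def a_kernel_def' congruence_ideal_def zero_iff[symmetric] by simp
qed

section \<open>Quadratic generation as connectivity\<close>

lemma size_2E: assumes "size M = 2" obtains a b where "M = {#a, b#}"
proof -
  obtain a R where "M = add_mset a R" "size R = 1"
    using assms by (metis Suc_1 size_eq_Suc_imp_eq_union size_add_mset add_diff_cancel_left' plus_1_eq_Suc)
  then show ?thesis using that by (metis size_1_singleton_mset)
qed

lemma keys_binomial:
  "u \<noteq> v \<Longrightarrow> Poly_Mapping.keys (Poly_Mapping.single u 1 - Poly_Mapping.single v 1 :: 'm \<Rightarrow>\<^sub>0 'k::field) = {u, v}"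
  by (auto simp: in_keys_iff lookup_minus lookup_single when_def split: if_splits)

text \<open>Two congruences are compared: equal weight, whose ideal is the toric ideal, and
  connectivity by moves. Membership of binomials detects either relation, so an inclusion of the
  ideals yields an inclusion of the relations; conversely, paths express binomials of equal weight
  through quadratic ones.\<close>

lemma toric_ideal_generated_by_quadratic_binomials_iff:
  "generated_by_quadratic_binomials (poly_ring (lattice_points Q))
     (toric_ideal Q :: (int ^ 'n::finite, 'k::field) mpoly set) \<longleftrightarrow>
   quadratically_connected (lattice_points Q)"
proof -
  define V where "V = lattice_points Q"
  define R :: "(int ^ 'n, 'k) mpoly ring" where "R = poly_ring V"
  define I :: "(int ^ 'n, 'k) mpoly set" where "I = toric_ideal Q"
  interpret R: cring R unfolding R_def by (rule cring_poly_ring)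
  let ?W = "\<lambda>u v. weight u = weight v"
  let ?E = "\<lambda>u v. connected_by_moves V (mset_of_monomial u) (mset_of_monomial v)"
  have I: "I = congruence_ideal V ?W"
    unfolding I_def V_def by (rule toric_ideal_eq_congruence_ideal)
  have W: "equivp ?W" by (auto intro!: equivpI reflpI sympI transpI)
  have ideal_I: "ideal I R"
    unfolding I R_def by (rule ideal_congruence_ideal) (simp add: weight_add)
  have E: "equivp ?E"
    using equivp_connected_by_moves[of V] unfolding equivp_def by (metis (no_types, lifting))
  have ideal_E: "ideal (congruence_ideal V ?E) R"
    unfolding R_def by (rule ideal_congruence_ideal)
      (use connected_by_moves_add in \<open>fastforce simp: add.commute\<close>)
  have bin_I: "Poly_Mapping.single u 1 - Poly_Mapping.single v 1 \<in> I \<longleftrightarrow> weight u = weight v"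
    if "Poly_Mapping.keys u \<subseteq> V" "Poly_Mapping.keys v \<subseteq> V" for u v
    unfolding I by (rule binomial_in_congruence_ideal_iff[OF W that])
  have "generated_by_quadratic_binomials R I \<longleftrightarrow> quadratically_connected V"
  proof
    assume "generated_by_quadratic_binomials R I"
    then obtain B where B: "B \<subseteq> carrier R" "\<forall>f\<in>B. quadratic_binomial f" "I = Idl\<^bsub>R\<^esub> B"
      unfolding generated_by_quadratic_binomials_def by blast
    \<comment> \<open>Each quadratic binomial in the toric ideal is a single move with empty
      rest.\<close>
    have "B \<subseteq> congruence_ideal V ?E"
    proof
      fix f assume f: "f \<in> B"
      then obtain u v where uv: "u \<noteq> v" "monomial_degree u = 2" "monomial_degree v = 2"
        "f = Poly_Mapping.single u 1 - Poly_Mapping.single v 1"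
        using B(2) unfolding quadratic_binomial_def by blast
      have "f \<in> carrier R" using f B(1) by blast
      then have V: "Poly_Mapping.keys u \<subseteq> V" "Poly_Mapping.keys v \<subseteq> V"
        unfolding R_def uv(4) using keys_binomial[OF uv(1), where 'k = 'k] by auto
      have "f \<in> I" using f B R.genideal_self by blast
      then have "weight u = weight v" using bin_I[OF V] uv(4) by simp
      obtain a b where ab: "mset_of_monomial u = {#a, b#}"
        using uv(2) size_2E unfolding monomial_degree_eq_size by metis
      obtain c d where cd: "mset_of_monomial v = {#c, d#}"
        using uv(3) size_2E unfolding monomial_degree_eq_size by metis
      have "{a, b, c, d} \<subseteq> V"
        using V unfolding set_mset_of_monomial[symmetric] ab cd by simp
      moreover have "a + b = c + d" using \<open>weight u = weight v\<close> ab cd by (simp add: weight_def)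
      ultimately have "?E u v" unfolding ab cd using quadratic_moveI[of a V b c d "{#}"] by auto
      then show "f \<in> congruence_ideal V ?E"
        unfolding uv(4) using binomial_in_congruence_ideal_iff[OF E V] by blast
    qed
    then have "I \<subseteq> congruence_ideal V ?E"
      unfolding B(3) by (rule R.genideal_minimal[OF ideal_E])
    show "quadratically_connected V"
      unfolding quadratically_connected_def
    proof (intro allI impI)
      fix M N assume MN: "set_mset M \<subseteq> V" "set_mset N \<subseteq> V" "size M = size N" "\<Sum>\<^sub># M = \<Sum>\<^sub># N"
      obtain u v where uv: "mset_of_monomial u = M" "mset_of_monomial v = N"
        using mset_of_monomial_surj by metis
      then have V: "Poly_Mapping.keys u \<subseteq> V" "Poly_Mapping.keys v \<subseteq> V"
        using MN by (auto simp flip: set_mset_of_monomial)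
      have "weight u = weight v" using MN uv by (simp add: weight_def)
      then have "Poly_Mapping.single u 1 - Poly_Mapping.single v 1 \<in> I" using bin_I[OF V] by blast
      then have "?E u v"
        using \<open>I \<subseteq> congruence_ideal V ?E\<close> binomial_in_congruence_ideal_iff[OF E V, where 'k = 'k] by blast
      then show "connected_by_moves V M N" unfolding uv .
    qed
  next
    assume conn: "quadratically_connected V"
    \<comment> \<open>All quadratic binomials of the ideal serve as generators.\<close>
    define B where "B = {f \<in> I. quadratic_binomial f}"
    have "I \<subseteq> carrier R" unfolding I R_def congruence_ideal_def by blast
    then have B: "B \<subseteq> carrier R" unfolding B_def by blast
    have J: "ideal (Idl\<^bsub>R\<^esub> B) (poly_ring V)" using R.genideal_ideal[OF B] unfolding R_def .
    have move: "Poly_Mapping.single u 1 - Poly_Mapping.single v 1 \<in> Idl\<^bsub>R\<^esub> B"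
      if "quadratic_move V (mset_of_monomial u) (mset_of_monomial v)" "Poly_Mapping.keys u \<subseteq> V" for u v
    proof -
      from that(1) obtain a b c d S where V: "{a, b, c, d} \<subseteq> V" and s: "a + b = c + d"
        and S: "mset_of_monomial u = {#a, b#} + S" "mset_of_monomial v = {#c, d#} + S"
        unfolding quadratic_move_def by blast
      obtain w x y where wxy: "mset_of_monomial w = S" "mset_of_monomial x = {#a, b#}" "mset_of_monomial y = {#c, d#}"
        using mset_of_monomial_surj by metis
      have "mset_of_monomial u = mset_of_monomial (w + x)" "mset_of_monomial v = mset_of_monomial (w + y)"
        by (simp_all add: S wxy add.commute)
      then have uv: "u = w + x" "v = w + y" unfolding mset_of_monomial_eq_iff .
      let ?f = "Poly_Mapping.single x 1 - Poly_Mapping.single y 1 :: (int ^ 'n, 'k) mpoly"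
      have f: "?f \<in> Idl\<^bsub>R\<^esub> B"
      proof (cases "x = y")
        \<comment> \<open>A trivial move yields zero, which is not a quadratic binomial but lies in
          every ideal.\<close>
        case True
        then show ?thesis using poly_ring_ideal_closed(1)[OF J] by simp
      next
        case False
        have "Poly_Mapping.keys x \<subseteq> V" "Poly_Mapping.keys y \<subseteq> V"
          using V wxy(2,3) by (auto simp flip: set_mset_of_monomial)
        moreover have "weight x = weight y" by (simp add: weight_def wxy s)
        ultimately have "?f \<in> I" using bin_I by blast
        moreover have "quadratic_binomial ?f"
          unfolding quadratic_binomial_def monomial_degree_eq_size using False wxy
          by (intro exI[of _ x] exI[of _ y]) auto
        ultimately show ?thesis using R.genideal_self[OF B] unfolding B_def by blast
      qed
      have "Poly_Mapping.keys w \<subseteq> V"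
        using that(2) S(1) wxy(1) by (auto simp flip: set_mset_of_monomial)
      then have w: "(Poly_Mapping.single w 1 :: (int ^ 'n, 'k) mpoly) \<in> carrier (poly_ring V)" by simp
      \<comment> \<open>The untouched rest of the move is the monomial factor \<open>w\<close> in
        front of the quadratic binomial.\<close>
      show ?thesis
        using poly_ring_ideal_closed(3)[OF J f w] by (simp add: uv right_diff_distrib mult_single)
    qed
    have path: "Poly_Mapping.single u 1 - Poly_Mapping.single v 1 \<in> Idl\<^bsub>R\<^esub> B"
      if "connected_by_moves V (mset_of_monomial u) N" "N = mset_of_monomial v" "Poly_Mapping.keys u \<subseteq> V" for u v N
      using that(1,2)
    proof (induction arbitrary: v rule: rtranclp_induct)
      case base
      then show ?case using poly_ring_ideal_closed(1)[OF J] by simp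
    next
      case (step L N)
      obtain w where w: "L = mset_of_monomial w" using mset_of_monomial_surj by metis
      have "Poly_Mapping.keys w \<subseteq> V"
        using connected_by_moves_invariants(3)[OF step.hyps(1)] that(3) w by simp
      then have "Poly_Mapping.single w 1 - Poly_Mapping.single v 1 \<in> Idl\<^bsub>R\<^esub> B"
        using move step.hyps(2) step.prems w by blast
      \<comment> \<open>The binomials telescope along the path: \<open>u - w\<close> plus
        \<open>w - v\<close> is \<open>u - v\<close>.\<close>
      from poly_ring_ideal_closed(2)[OF J step.IH[OF w] this] show ?case by simp
    qed
    have "I \<subseteq> Idl\<^bsub>R\<^esub> B"
      unfolding I
    proof (rule congruence_ideal_subset[OF W])
      show "ideal (Idl\<^bsub>R\<^esub> B) (poly_ring V)" by (rule J)
      fix u v :: "int ^ 'n \<Rightarrow>\<^sub>0 nat"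
      assume "weight u = weight v" and V: "Poly_Mapping.keys u \<subseteq> V" "Poly_Mapping.keys v \<subseteq> V"
      then have "connected_by_moves V (mset_of_monomial u) (mset_of_monomial v)"
        using conn unfolding quadratically_connected_def weight_def by simp
      from path[OF this refl V(1)] show "Poly_Mapping.single u 1 - Poly_Mapping.single v 1 \<in> Idl\<^bsub>R\<^esub> B" .
    qed
    moreover have "Idl\<^bsub>R\<^esub> B \<subseteq> I"
      by (rule R.genideal_minimal[OF ideal_I]) (auto simp: B_def)
    ultimately show "generated_by_quadratic_binomials R I"
      unfolding generated_by_quadratic_binomials_def using B by (intro exI[of _ B]) (auto simp: B_def)
  qed
  then show ?thesis unfolding V_def R_def I_def .
qed

section \<open>Lattice points of the signed copies and the conclusion\<close>

lemma lattice_points_signed_copies: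
  fixes P :: "(real ^ 'n) set"
  assumes "\<forall>x\<in>P. \<forall>i. 0 \<le> x $ i"
  shows "lattice_points (signed_copies P) = signed_points (lattice_points P)"
proof (intro Set.set_eqI iffI)
  fix a assume "a \<in> lattice_points (signed_copies P)"
  then obtain \<epsilon> :: "real ^ 'n" and x where
    *: "(\<chi> i. real_of_int (a $ i)) = (\<chi> i. \<epsilon> $ i * x $ i)" "\<forall>i. \<epsilon> $ i \<in> {-1, 1}" "x \<in> P"
    unfolding lattice_points_def signed_copies_def by auto
  have "real_of_int \<bar>a $ i\<bar> = x $ i" for i
  proof -
    have "real_of_int (a $ i) = \<epsilon> $ i * x $ i" using *(1) by (simp add: vec_eq_iff)
    moreover have "\<epsilon> $ i = -1 \<or> \<epsilon> $ i = 1" using *(2) by auto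
    moreover have "0 \<le> x $ i" using assms *(3) by blast
    ultimately show ?thesis by auto
  qed
  then have "(\<chi> i. real_of_int \<bar>a $ i\<bar>) = x" by (simp add: vec_eq_iff)
  then show "a \<in> signed_points (lattice_points P)"
    using *(3) by (simp add: signed_points_def lattice_points_def)
next
  fix a assume "a \<in> signed_points (lattice_points P)"
  then have P: "(\<chi> i. real_of_int \<bar>a $ i\<bar>) \<in> P" by (simp add: signed_points_def lattice_points_def)
  show "a \<in> lattice_points (signed_copies P)"
    unfolding lattice_points_def signed_copies_def mem_Collect_eq
    \<comment> \<open>The witnesses are the signs and the absolute values of \<open>a\<close>; at a
      zero entry the sign defaults to 1.\<close>
    by (intro exI[of _ "\<chi> i. if a $ i < 0 then -1 else 1"] exI[of _ "\<chi> i. real_of_int \<bar>a $ i\<bar>"] conjI P)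
      (auto simp: vec_eq_iff)
qed

theorem theorem1p2:
  fixes P :: "(real ^ 'n) set"
  assumes "lattice_polytope P"
    and "\<forall>x\<in>P. \<forall>i. 0 \<le> x $ i"
    and "aff_dim P = int CARD('n)"
    and "anti_blocking P"
  shows "generated_by_quadratic_binomials (poly_ring (lattice_points P))
           (toric_ideal P :: (int ^ 'n, 'k::field) mpoly set) \<longleftrightarrow>
         generated_by_quadratic_binomials (poly_ring (lattice_points (signed_copies P)))
           (toric_ideal (signed_copies P) :: (int ^ 'n, 'k) mpoly set)"
proof -
  let ?A = "lattice_points P"
  have down: "down_closed ?A"
    using assms(4) unfolding down_closed_def anti_blocking_def lattice_points_def by fastforce
  have nonneg: "0 \<le> x $ i" if "x \<in> ?A" for x i
    using assms(2) that unfolding lattice_points_def by fastforce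
  have "quadratically_connected ?A \<longleftrightarrow> quadratically_connected (signed_points ?A)"
    using quadratically_connected_imp_signed[OF down _ nonneg]
      quadratically_connected_signed_imp[OF down nonneg] by blast
  then show ?thesis
    unfolding toric_ideal_generated_by_quadratic_binomials_iff
    unfolding lattice_points_signed_copies[OF assms(2)] .
qed

end
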